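(* Let $T$ be an $n\times n$ stochastic matrix having $1$ as a simple eigenvalue. Consider a singular value decomposition $I-T=U\Sigma V^\top$, and let $u,v$ be (unit) left and right singular vectors, respectively, corresponding to a singular value $\sigma>0$ of $I-T$. Suppose that $$u^\top=\left[\,u_1^\top\;\middle|\;-u_2^\top\;\middle|\;0^\top\,\right],$$ where $u_1\in\mathbb{R}^{\ell}$ and $u_2\in\mathbb{R}^{m-\ell}$ are both (entrywise) positive vectors, $1\le \ell\le m-1$, $m\le n$ (the zero block, of length $n-m$, may be absent). Let $T_{11}$ and $T_{22}$ denote the principal submatrices of $T$ on the indices $\{1,\dots,\ell\}$ and $\{\ell+1,\dots,m\}$, respectively. Then $$\max_{j=1,2}\omega_{|u|}(T;j,j)=\max\left\{\frac{u_1^\top T_{11}\mathbf 1}{u_1^\top\mathbf 1},\ \frac{u_2^\top T_{22}\mathbf 1}{u_2^\top\mathbf 1}\right\}\ge 1-\sigma\sqrt{m}\ge 1-\sigma\sqrt{n}.$$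
   Context: All matrices and vectors are real. A matrix in $\mathbb{R}^{n\times n}$ is stochastic if its entries are nonnegative and each row sums to $1$. $\mathbf 1$ is the all-ones vector of the appropriate dimension, and $|u|$ is the entrywise absolute value. Left and right singular vectors $u,v$ for $\sigma$ are corresponding columns of $U$ and $V$, so $\|u\|_2=\|v\|_2=1$ and $u^\top(I-T)=\sigma v^\top$. For a block matrix $A=[A_{ij}]$ and a vector $w=[w_1^\top|\cdots|w_k^\top]^\top$ partitioned conformally with $A$, $\omega_w(A;i,j):=\dfrac{w_i^\top A_{ij}\mathbf 1}{w_i^\top\mathbf 1}$; here $T$ is partitioned conformally with $u$ and only the blocks $j=1,2$, on which $|u|$ is positive, are used. *)

theory Defs
  imports
    Complex_Main
    "Jordan_Normal_Form.Char_Poly"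
    "Jordan_Normal_Form.DL_Submatrix"
begin

definition stochastic_mat :: "nat \<Rightarrow> real mat \<Rightarrow> bool" where
  "stochastic_mat n T \<longleftrightarrow> T \<in> carrier_mat n n \<and>
     (\<forall>i<n. \<forall>j<n. T $$ (i,j) \<ge> 0) \<and> (\<forall>i<n. (\<Sum>j<n. T $$ (i,j)) = 1)"

text \<open>Simplicity refers to the algebraic multiplicity.\<close>

definition simple_eigenvalue :: "real mat \<Rightarrow> real \<Rightarrow> bool" where
  "simple_eigenvalue A k \<longleftrightarrow> eigenvalue A k \<and> Polynomial.order k (char_poly A) = 1"

text \<open>
  The library predicate \<^const>\<open>orthogonal_mat\<close> only asks for pairwise orthogonal nonzero
  columns; here the columns are orthonormal.
\<close>

definition real_orthogonal :: "nat \<Rightarrow> real mat \<Rightarrow> bool" where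
  "real_orthogonal n U \<longleftrightarrow> U \<in> carrier_mat n n \<and> transpose_mat U * U = 1\<^sub>m n"

text \<open>
  The singular values on the diagonal of \<open>S\<close> may appear in any order.
\<close>

definition is_svd :: "nat \<Rightarrow> real mat \<Rightarrow> real mat \<Rightarrow> real mat \<Rightarrow> real mat \<Rightarrow> bool" where
  "is_svd n A U S V \<longleftrightarrow>
     real_orthogonal n U \<and> real_orthogonal n V \<and>
     S \<in> carrier_mat n n \<and> diagonal_mat S \<and> (\<forall>i<n. S $$ (i,i) \<ge> 0) \<and>
     A = U * S * transpose_mat V"

definition ones_vec :: "nat \<Rightarrow> real vec" where
  "ones_vec n = vec n (\<lambda>_. 1)"

definition abs_vec :: "real vec \<Rightarrow> real vec" where
  "abs_vec v = map_vec abs v"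

definition pos_vec :: "real vec \<Rightarrow> bool" where
  "pos_vec v \<longleftrightarrow> (\<forall>i<dim_vec v. v $ i > 0)"

text \<open>
  A partition of the index range into consecutive blocks is given by the list \<open>ns\<close> of block
  sizes. Blocks, like matrix and vector indices, are numbered from \<open>0\<close>. A size may be \<open>0\<close>.
\<close>

definition block_idx :: "nat list \<Rightarrow> nat \<Rightarrow> nat set" where
  "block_idx ns i = {sum_list (take i ns) ..< sum_list (take (Suc i) ns)}"

definition block :: "nat list \<Rightarrow> 'a mat \<Rightarrow> nat \<Rightarrow> nat \<Rightarrow> 'a mat" where
  "block ns A i j = submatrix A (block_idx ns i) (block_idx ns j)"

definition vec_block :: "nat list \<Rightarrow> 'a vec \<Rightarrow> nat \<Rightarrow> 'a vec" where
  "vec_block ns w i = vec (ns ! i) (\<lambda>a. w $ (sum_list (take i ns) + a))"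

definition omega :: "nat list \<Rightarrow> real vec \<Rightarrow> real mat \<Rightarrow> nat \<Rightarrow> nat \<Rightarrow> real" where
  "omega ns w A i j =
     (vec_block ns w i \<bullet> (block ns A i j *\<^sub>v ones_vec (ns ! j))) /
     (vec_block ns w i \<bullet> ones_vec (ns ! i))"

end

(*
  Comparing rows in U^T (I - T) = S V^T gives u^T (I - T) = sigma v^T.  Summing the entries of
  this identity over the support of u1 and dropping the nonnegative contribution of u2 to these
  columns bounds u1^T (I - T11) 1 by sigma times the sum of v over the support; the same holds
  for u2 with -v.  By Cauchy-Schwarz the two bounds add up to at most sigma sqrt m, while
  u1^T 1 + u2^T 1 is the 1-norm of the unit vector u, so at least 1.  The maximum of the two
  quotients dominates their mediant.
*)
theory Submission
  imports Defs "HOL-Analysis.L2_Norm"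
begin

section \<open>Sums over diagonal blocks, in global indices\<close>

lemma pick_atLeastLessThan:
  assumes "i < b - a"
  shows "pick {a..<b} i = a + i"
proof -
  \<comment> \<open>Exactly \<open>i\<close> members of the interval lie below \<open>a + i\<close>,
    so \<open>pick\<close>, which counts from 0, gives it the number \<open>i\<close>.\<close>
  have "{x \<in> {a..<b}. x < a + i} = {a..<a + i}"
    using assms by auto
  then show ?thesis
    using pick_card_in_set[of "a + i" "{a..<b}"] assms by simp
qed

lemma dim_submatrix_atLeastLessThan:
  assumes "A \<in> carrier_mat n n" "b \<le> n"
  shows "dim_row (submatrix A {a..<b} {a..<b}) = b - a"
    "dim_col (submatrix A {a..<b} {a..<b}) = b - a"
proof -
  have "{i. i < n \<and> i \<in> {a..<b}} = {a..<b}"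
    using assms(2) by auto
  then show "dim_row (submatrix A {a..<b} {a..<b}) = b - a"
    "dim_col (submatrix A {a..<b} {a..<b}) = b - a"
    using assms(1) by (simp_all only: dim_submatrix carrier_matD card_atLeastLessThan)
qed

lemma submatrix_atLeastLessThan_index:
  assumes "A \<in> carrier_mat n n" "b \<le> n" "i < b - a" "j < b - a"
  shows "submatrix A {a..<b} {a..<b} $$ (i, j) = A $$ (a + i, a + j)"
  using assms dim_submatrix_atLeastLessThan[OF assms(1,2), of a]
  by (subst submatrix_index) (simp_all only: dim_submatrix pick_atLeastLessThan)

text \<open>Block positions are shifted to global indices, so that block sums can later be compared
  with sums over whole columns of \<open>T\<close>.\<close>

lemma scalar_prod_ones_vec:
  assumes "x \<in> carrier_vec (b - a)"
  shows "x \<bullet> ones_vec (b - a) = (\<Sum>i\<in>{a..<b}. x $ (i - a))"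
proof -
  have "x \<bullet> ones_vec (b - a) = (\<Sum>i\<in>{0..<b - a}. x $ i)"
    by (simp add: scalar_prod_def ones_vec_def)
  also have "\<dots> = (\<Sum>i\<in>{a..<b}. x $ (i - a))"
    by (rule sum.reindex_bij_witness[of _ "\<lambda>i. i - a" "\<lambda>i. i + a"]) auto
  finally show ?thesis .
qed

lemma scalar_prod_submatrix_ones_vec:
  assumes A: "A \<in> carrier_mat n n" and b: "b \<le> n" and x: "x \<in> carrier_vec (b - a)"
  shows "x \<bullet> (submatrix A {a..<b} {a..<b} *\<^sub>v ones_vec (b - a)) =
    (\<Sum>i\<in>{a..<b}. \<Sum>j\<in>{a..<b}. x $ (i - a) * A $$ (i, j))"
proof -
  let ?B = "submatrix A {a..<b} {a..<b}"
  note dims = dim_submatrix_atLeastLessThan[OF A b, of a]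
  have "x \<bullet> (?B *\<^sub>v ones_vec (b - a)) =
      (\<Sum>i\<in>{0..<b - a}. x $ i * (\<Sum>j\<in>{0..<b - a}. ?B $$ (i, j)))"
    by (simp add: scalar_prod_def mult_mat_vec_def ones_vec_def dims)
  also have "\<dots> = (\<Sum>i\<in>{0..<b - a}. \<Sum>j\<in>{0..<b - a}. x $ i * A $$ (a + i, a + j))"
    by (simp add: sum_distrib_left submatrix_atLeastLessThan_index[OF A b])
  also have "\<dots> = (\<Sum>i\<in>{0..<b - a}. \<Sum>j\<in>{a..<b}. x $ i * A $$ (a + i, j))"
    by (intro sum.cong refl sum.reindex_bij_witness[of _ "\<lambda>j. j - a" "\<lambda>j. j + a"])
      (auto simp: add.commute)
  also have "\<dots> = (\<Sum>i\<in>{a..<b}. \<Sum>j\<in>{a..<b}. x $ (i - a) * A $$ (i, j))"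
    by (rule sum.reindex_bij_witness[of _ "\<lambda>i. i - a" "\<lambda>i. i + a"]) (auto simp: add.commute)
  finally show ?thesis .
qed

text \<open>The hypothesis holds by evaluation for a concrete list of sizes; it turns the upper end
  of the block into offset plus size.\<close>

lemma omega_diagonal_block:
  assumes "take (Suc i) ns = take i ns @ [ns ! i]"
  shows "omega ns w A i i =
    (vec_block ns w i \<bullet> (submatrix A {sum_list (take i ns)..<sum_list (take i ns) + ns ! i}
        {sum_list (take i ns)..<sum_list (take i ns) + ns ! i} *\<^sub>v ones_vec (ns ! i))) /
    (vec_block ns w i \<bullet> ones_vec (ns ! i))"
  by (simp add: omega_def block_def block_idx_def assms)

section \<open>Singular vectors and bounds on column sums\<close>

lemma real_orthogonal_col_norm:
  assumes "real_orthogonal n U" "k < n"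
  shows "L2_set (\<lambda>i. U $$ (i, k)) {..<n} = 1"
proof -
  have U: "U \<in> carrier_mat n n" and "transpose_mat U * U = 1\<^sub>m n"
    using assms(1) by (auto simp: real_orthogonal_def)
  then have "(transpose_mat U * U) $$ (k, k) = 1"
    using assms(2) by simp
  then have "(\<Sum>i\<in>{0..<n}. U $$ (i, k) * U $$ (i, k)) = 1"
    using U assms(2) by (simp add: scalar_prod_def)
  then show ?thesis
    by (simp add: L2_set_def power2_eq_square atLeast0LessThan)
qed

text \<open>Multiplying the decomposition by the transpose of \<open>U\<close> cancels
  \<open>U\<close>; since \<open>S\<close> is diagonal, row \<open>k\<close> of what remains is a
  multiple of column \<open>k\<close> of \<open>V\<close>.\<close>

lemma is_svd_left_singular_vector:
  assumes svd: "is_svd n A U S V" and k: "k < n" and j: "j < n"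
  shows "(\<Sum>i<n. U $$ (i, k) * A $$ (i, j)) = S $$ (k, k) * V $$ (j, k)"
proof -
  have U: "U \<in> carrier_mat n n" and V: "V \<in> carrier_mat n n" and S: "S \<in> carrier_mat n n"
    and UU: "transpose_mat U * U = 1\<^sub>m n" and diag: "diagonal_mat S"
    and A: "A = U * S * transpose_mat V"
    using svd by (auto simp: is_svd_def real_orthogonal_def)
  have A': "A \<in> carrier_mat n n"
    using U V S A by auto
  have "transpose_mat U * A = (transpose_mat U * U) * (S * transpose_mat V)"
    unfolding A using U V S
    by (simp add: assoc_mult_mat[of _ n n _ n _ n])
  also have "\<dots> = S * transpose_mat V"
    using UU S V by (simp add: left_mult_one_mat[of _ n n])
  finally have eq: "(transpose_mat U * A) $$ (k, j) = (S * transpose_mat V) $$ (k, j)"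
    by simp
  have "(transpose_mat U * A) $$ (k, j) = (\<Sum>i\<in>{0..<n}. U $$ (i, k) * A $$ (i, j))"
    using U A' k j by (simp add: scalar_prod_def)
  moreover have "(S * transpose_mat V) $$ (k, j) = (\<Sum>i\<in>{0..<n}. S $$ (k, i) * V $$ (j, i))"
    using S V k j by (simp add: scalar_prod_def)
  moreover have "\<dots> = (\<Sum>i\<in>{0..<n}. if i = k then S $$ (k, k) * V $$ (j, k) else 0)"
    using diag S k by (intro sum.cong) (auto simp: diagonal_mat_def)
  ultimately show ?thesis
    using eq k by (simp add: atLeast0LessThan)
qed

text \<open>Rows outside \<open>P\<close> contribute nonpositively to every column, so restricting
  the subtracted sum to \<open>P\<close> can only lower the left side of \<open>sing\<close>; then
  sum over the columns in \<open>P\<close>. Only signs off \<open>P\<close> are prescribed, so the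
  bound serves \<open>w\<close> on one block and \<open>- w\<close> on the other.\<close>

lemma escaping_mass_le:
  fixes w y :: "'a \<Rightarrow> real"
  assumes I: "finite I" and P: "P \<subseteq> I"
    and t: "\<And>i j. i \<in> I \<Longrightarrow> j \<in> I \<Longrightarrow> t i j \<ge> 0"
    and w: "\<And>i. i \<in> I - P \<Longrightarrow> w i \<le> 0"
    and sing: "\<And>j. j \<in> I \<Longrightarrow> w j - (\<Sum>i\<in>I. w i * t i j) = \<sigma> * y j"
  shows "(\<Sum>j\<in>P. w j) - (\<Sum>i\<in>P. \<Sum>j\<in>P. w i * t i j) \<le> \<sigma> * (\<Sum>j\<in>P. y j)"
proof -
  have "(\<Sum>j\<in>P. w j - (\<Sum>i\<in>P. w i * t i j)) \<le> (\<Sum>j\<in>P. \<sigma> * y j)"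
  proof (rule sum_mono)
    fix j assume j: "j \<in> P"
    have "(\<Sum>i\<in>I. w i * t i j) = (\<Sum>i\<in>I - P. w i * t i j) + (\<Sum>i\<in>P. w i * t i j)"
      by (rule sum.subset_diff[OF P I])
    moreover have "(\<Sum>i\<in>I - P. w i * t i j) \<le> 0"
      using P j t w by (intro sum_nonpos mult_nonpos_nonneg) auto
    ultimately show "w j - (\<Sum>i\<in>P. w i * t i j) \<le> \<sigma> * y j"
      using sing[of j] P j by auto
  qed
  moreover have "(\<Sum>i\<in>P. \<Sum>j\<in>P. w i * t i j) = (\<Sum>j\<in>P. \<Sum>i\<in>P. w i * t i j)"
    by (rule sum.swap)
  ultimately show ?thesis
    by (simp add: sum_subtractf sum_distrib_left)
qed

text \<open>Cauchy-Schwarz against the constant 1 on \<open>J\<close>; restricting \<open>y\<close>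
  to \<open>J\<close> does not increase its norm.\<close>

lemma sum_abs_le_sqrt_card:
  assumes "finite I" "J \<subseteq> I" "L2_set y I = 1"
  shows "(\<Sum>j\<in>J. \<bar>y j\<bar>) \<le> sqrt (card J)"
proof -
  have "(\<Sum>j\<in>J. \<bar>y j\<bar>) \<le> L2_set y J * L2_set (\<lambda>_. 1) J"
    using L2_set_mult_ineq[of y "\<lambda>_. 1" J] by simp
  also have "L2_set y J \<le> L2_set y I"
    unfolding L2_set_def using assms by (intro real_sqrt_le_mono sum_mono2) auto
  finally show ?thesis
    using assms(3) by (simp add: L2_set_def mult_right_mono)
qed

lemma mediant_le_max:
  fixes p q r s :: real
  assumes "s > 0" "r > 0"
  shows "(p + q) / (s + r) \<le> max (p / s) (q / r)"
proof -
  \<comment> \<open>The mediant is the average of the two quotients with weights \<open>s\<close>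
    and \<open>r\<close>.\<close>
  have "p \<le> max (p / s) (q / r) * s" "q \<le> max (p / s) (q / r) * r"
    using assms by (simp_all add: pos_divide_le_eq[symmetric])
  then have "p + q \<le> max (p / s) (q / r) * (s + r)"
    by (simp add: distrib_left)
  then show ?thesis
    using assms by (simp add: pos_divide_le_eq)
qed

text \<open>The mediant falls short of 1 by at most \<open>c / (s + r)\<close>, and this is at most
  \<open>c\<close> because \<open>s + r\<close> is at least 1.\<close>

lemma max_quotient_ge:
  fixes p q r s c :: real
  assumes "s > 0" "r > 0" "s + r \<ge> 1" "c \<ge> 0" "(s - p) + (r - q) \<le> c"
  shows "max (p / s) (q / r) \<ge> 1 - c"
proof -
  have "(1 - c) * (s + r) \<le> (s + r) - c"
    using mult_left_mono[OF assms(3,4)] by (simp add: algebra_simps)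
  then have "1 - c \<le> (p + q) / (s + r)"
    using assms by (simp add: pos_le_divide_eq)
  then show ?thesis
    using mediant_le_max[OF assms(1,2), of p q] by linarith
qed

section \<open>Sign pattern of \<open>u\<close> and the estimate for the two blocks\<close>

theorem theorem2p18:
  fixes n m l k :: nat
    and T U S V :: "real mat"
    and u v u1 u2 :: "real vec"
    and \<sigma> :: real
  assumes "stochastic_mat n T"
    and "simple_eigenvalue T 1"
    and "is_svd n (1\<^sub>m n - T) U S V"
    and "k < n" and "u = col U k" and "v = col V k" and "\<sigma> = S $$ (k,k)"
    and "\<sigma> > 0"
    and "1 \<le> l" and "l \<le> m - 1" and "m \<le> n"
    and "u1 \<in> carrier_vec l" and "pos_vec u1"
    and "u2 \<in> carrier_vec (m - l)" and "pos_vec u2"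
    and "u = u1 @\<^sub>v (- u2) @\<^sub>v 0\<^sub>v (n - m)"
  defines "T11 \<equiv> submatrix T {0..<l} {0..<l}"
    and "T22 \<equiv> submatrix T {l..<m} {l..<m}"
  shows "Max ((\<lambda>j. omega [l, m - l, n - m] (abs_vec u) T j j) ` {0, 1}) =
           max ((u1 \<bullet> (T11 *\<^sub>v ones_vec l)) / (u1 \<bullet> ones_vec l))
               ((u2 \<bullet> (T22 *\<^sub>v ones_vec (m - l))) / (u2 \<bullet> ones_vec (m - l)))
       \<and> max ((u1 \<bullet> (T11 *\<^sub>v ones_vec l)) / (u1 \<bullet> ones_vec l))
             ((u2 \<bullet> (T22 *\<^sub>v ones_vec (m - l))) / (u2 \<bullet> ones_vec (m - l)))
           \<ge> 1 - \<sigma> * sqrt (real m)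
       \<and> 1 - \<sigma> * sqrt (real m) \<ge> 1 - \<sigma> * sqrt (real n)"
proof -
  note T = assms(1) and svd = assms(3) and k = assms(4) and u = assms(5)
    and \<sigma> = assms(7) and \<sigma>0 = assms(8) and l = assms(9,10) and m = assms(11)
    and u1 = assms(12,13) and u2 = assms(14,15) and ueq = assms(16)
  define P where "P = {0..<l}"
  define Q where "Q = {l..<m}"
  define w where "w i = u $ i" for i
  define y where "y j = V $$ (j, k)" for j
  \<comment> \<open>Although \<open>m - 1\<close> is truncated, \<open>1 \<le> l\<close> excludes
    \<open>m = 0\<close>.\<close>
  have lm: "l < m" using l by linarith
  have dims: "dim_vec u1 = l" "dim_vec u2 = m - l"
    using u1 u2 by auto
  have Tc: "T \<in> carrier_mat n n" and Tnn: "\<And>i j. i < n \<Longrightarrow> j < n \<Longrightarrow> T $$ (i, j) \<ge> 0"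
    using T by (auto simp: stochastic_mat_def)
  have ort: "real_orthogonal n U" "real_orthogonal n V"
    using svd by (auto simp: is_svd_def)
  then have Uc: "U \<in> carrier_mat n n"
    by (simp add: real_orthogonal_def)
  have wU: "w i = U $$ (i, k)" if "i < n" for i
    using that Uc k by (simp add: w_def u)
  have w1: "w i = u1 $ i" if "i < l" for i
    using that lm dims by (simp add: w_def ueq)
  have w2: "w i = - u2 $ (i - l)" if "l \<le> i" "i < m" for i
    using that diff_less_mono[OF that(2,1)] lm dims by (simp add: w_def ueq)
  have w3: "w i = 0" if "m \<le> i" "i < n" for i
    using that lm dims m by (simp add: w_def ueq)
  have wP: "w i > 0" if "i < l" for i
    using that u1 dims by (simp add: w1 pos_vec_def)
  have wQ: "w i < 0" if "l \<le> i" "i < m" for i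
    using that u2 dims by (simp add: w2 pos_vec_def)
  \<comment> \<open>Column \<open>j\<close> of the singular vector identity; the identity matrix
    contributes the isolated \<open>w j\<close>.\<close>
  have sing: "w j - (\<Sum>i<n. w i * T $$ (i, j)) = \<sigma> * y j" if j: "j < n" for j
  proof -
    have "\<sigma> * y j = (\<Sum>i<n. U $$ (i, k) * (1\<^sub>m n - T) $$ (i, j))"
      using is_svd_left_singular_vector[OF svd k j] by (simp add: \<sigma> y_def)
    also have "\<dots> = (\<Sum>i<n. (if i = j then w i else 0) - w i * T $$ (i, j))"
      using Tc j by (intro sum.cong) (auto simp: wU algebra_simps)
    finally show ?thesis
      using j by (simp add: sum_subtractf)
  qed
  have normy: "L2_set y {..<n} = 1"
    unfolding y_def by (rule real_orthogonal_col_norm[OF ort(2) k])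
  have normw: "L2_set w {..<n} = 1"
    using real_orthogonal_col_norm[OF ort(1) k] by (simp add: wU cong: L2_set_cong_simp)

  have s: "u1 \<bullet> ones_vec l = (\<Sum>i\<in>P. w i)"
    using scalar_prod_ones_vec[of u1 l 0] u1 by (simp add: P_def w1)
  \<comment> \<open>On \<open>Q\<close> the vector \<open>u\<close> carries \<open>- u2\<close>,
    hence the minus sign here and in \<open>q\<close>.\<close>
  have r: "u2 \<bullet> ones_vec (m - l) = - (\<Sum>i\<in>Q. w i)"
    using scalar_prod_ones_vec[of u2 m l] u2 by (simp add: Q_def w2 sum_negf)
  have p: "u1 \<bullet> (T11 *\<^sub>v ones_vec l) = (\<Sum>i\<in>P. \<Sum>j\<in>P. w i * T $$ (i, j))"
    using scalar_prod_submatrix_ones_vec[OF Tc, of l u1 0] u1 lm m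
    by (simp add: P_def w1 T11_def)
  have q: "u2 \<bullet> (T22 *\<^sub>v ones_vec (m - l)) = - (\<Sum>i\<in>Q. \<Sum>j\<in>Q. w i * T $$ (i, j))"
    using scalar_prod_submatrix_ones_vec[OF Tc, of m u2 l] u2 lm m
    by (simp add: Q_def w2 T22_def sum_negf)

  have s0: "u1 \<bullet> ones_vec l > 0"
    unfolding s using l by (intro sum_pos) (auto simp: P_def wP)
  have r0: "u2 \<bullet> ones_vec (m - l) > 0"
    unfolding r sum_negf[symmetric] using lm by (intro sum_pos) (auto simp: Q_def wQ)
  have split_m: "{..<m} = P \<union> Q" "P \<inter> Q = {}" "finite P" "finite Q"
    using lm by (auto simp: P_def Q_def)
  \<comment> \<open>The 1-norm dominates the 2-norm, which is 1 for \<open>u\<close>; by the sign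
    pattern the 1-norm is the sum of the two denominators.\<close>
  have "1 \<le> (\<Sum>i<n. \<bar>w i\<bar>)"
    using L2_set_le_sum_abs[of w "{..<n}"] normw by simp
  also have "\<dots> = (\<Sum>i<m. \<bar>w i\<bar>)"
    using m w3 by (intro sum.mono_neutral_right) auto
  also have "\<dots> = (\<Sum>i\<in>P. \<bar>w i\<bar>) + (\<Sum>i\<in>Q. \<bar>w i\<bar>)"
    by (simp add: split_m sum.union_disjoint)
  also have "(\<Sum>i\<in>P. \<bar>w i\<bar>) = (\<Sum>i\<in>P. w i)"
    by (rule sum.cong) (auto simp: P_def abs_of_pos wP)
  also have "(\<Sum>i\<in>Q. \<bar>w i\<bar>) = - (\<Sum>i\<in>Q. w i)"
    unfolding sum_negf[symmetric] by (rule sum.cong) (auto simp: Q_def abs_of_neg wQ)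
  finally have sr: "1 \<le> u1 \<bullet> ones_vec l + u2 \<bullet> ones_vec (m - l)"
    by (simp add: s r)

  have escP: "(\<Sum>j\<in>P. w j) - (\<Sum>i\<in>P. \<Sum>j\<in>P. w i * T $$ (i, j)) \<le> \<sigma> * (\<Sum>j\<in>P. y j)"
  proof (rule escaping_mass_le[of "{..<n}"])
    show "w i \<le> 0" if "i \<in> {..<n} - P" for i
      using that wQ[of i] w3[of i] by (cases "i < m") (auto simp: P_def)
  qed (use lm m sing Tnn in \<open>auto simp: P_def\<close>)
  \<comment> \<open>Negating both singular vectors preserves the identity and exchanges the roles of
    the blocks: \<open>- w\<close> is nonpositive off \<open>Q\<close>.\<close>
  have escQ: "(\<Sum>j\<in>Q. - w j) - (\<Sum>i\<in>Q. \<Sum>j\<in>Q. - w i * T $$ (i, j)) \<le> \<sigma> * (\<Sum>j\<in>Q. - y j)"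
  proof (rule escaping_mass_le[of "{..<n}"])
    show "- w i \<le> 0" if "i \<in> {..<n} - Q" for i
      using that wP[of i] w3[of i] by (cases "i < l") (auto simp: Q_def)
    show "- w j - (\<Sum>i<n. - w i * T $$ (i, j)) = \<sigma> * - y j" if "j \<in> {..<n}" for j
      using sing[of j] that by (simp add: sum_negf)
  qed (use lm m Tnn in \<open>auto simp: Q_def\<close>)
  \<comment> \<open>Both sums are bounded together: \<open>P\<close> and \<open>Q\<close> are
    disjoint, so a single Cauchy-Schwarz over \<open>m\<close> entries of the unit vector gives
    \<open>sqrt m\<close>, where separate bounds would add two square roots.\<close>
  have "(\<Sum>j\<in>P. y j) + (\<Sum>j\<in>Q. - y j) \<le> (\<Sum>j\<in>P. \<bar>y j\<bar>) + (\<Sum>j\<in>Q. \<bar>y j\<bar>)"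
    by (intro add_mono sum_mono) auto
  also have "\<dots> = (\<Sum>j<m. \<bar>y j\<bar>)"
    by (simp add: split_m sum.union_disjoint)
  also have "\<dots> \<le> sqrt m"
    using sum_abs_le_sqrt_card[of "{..<n}" "{..<m}" y] m normy by simp
  finally have "\<sigma> * ((\<Sum>j\<in>P. y j) + (\<Sum>j\<in>Q. - y j)) \<le> \<sigma> * sqrt m"
    using \<sigma>0 by simp
  then have esc: "(u1 \<bullet> ones_vec l - u1 \<bullet> (T11 *\<^sub>v ones_vec l)) +
      (u2 \<bullet> ones_vec (m - l) - u2 \<bullet> (T22 *\<^sub>v ones_vec (m - l))) \<le> \<sigma> * sqrt m"
    using escP escQ unfolding s r p q by (simp add: sum_negf algebra_simps)

  have bl1: "vec_block [l, m - l, n - m] (abs_vec u) 0 = u1"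
  proof (rule eq_vecI)
    fix i assume "i < dim_vec u1"
    then have "i < l" "i < dim_vec u"
      using dims by (auto simp: ueq)
    then show "vec_block [l, m - l, n - m] (abs_vec u) 0 $ i = u1 $ i"
      using wP[of i] w1[of i] by (simp add: vec_block_def abs_vec_def flip: w_def)
  qed (simp add: vec_block_def dims)
  \<comment> \<open>The absolute value undoes the minus sign in front of \<open>u2\<close>.\<close>
  have bl2: "vec_block [l, m - l, n - m] (abs_vec u) 1 = u2"
  proof (rule eq_vecI)
    fix i assume "i < dim_vec u2"
    then have "i < m - l" "l + i < m" "l + i < dim_vec u"
      using dims lm by (auto simp: ueq)
    then show "vec_block [l, m - l, n - m] (abs_vec u) 1 $ i = u2 $ i"
      using wQ[of "l + i"] w2[of "l + i"]
      by (simp add: vec_block_def abs_vec_def flip: w_def)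
  qed (simp add: vec_block_def dims)
  have "omega [l, m - l, n - m] (abs_vec u) T 0 0 =
      (u1 \<bullet> (T11 *\<^sub>v ones_vec l)) / (u1 \<bullet> ones_vec l)"
    using bl1 by (simp add: omega_diagonal_block T11_def)
  \<comment> \<open>The second block ends at \<open>l + (m - l)\<close>, which is \<open>m\<close>
    because \<open>l < m\<close>.\<close>
  moreover have "omega [l, m - l, n - m] (abs_vec u) T 1 1 =
      (u2 \<bullet> (T22 *\<^sub>v ones_vec (m - l))) / (u2 \<bullet> ones_vec (m - l))"
    using bl2 lm by (simp add: omega_diagonal_block T22_def)
  moreover have "1 - \<sigma> * sqrt m \<ge> 1 - \<sigma> * sqrt n"
    using m \<sigma>0 by simp
  ultimately show ?thesis
    using max_quotient_ge[OF s0 r0 sr _ esc] \<sigma>0 by simp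
qed

end
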